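(* For every $k\ge 1$, the trees $A_k$ and $B_k$ are both local amoebas and global amoebas.
   Context: The trees $A_k$: $A_1$ is a single vertex; for $k\ge 2$, $A_k$ is obtained from two disjoint copies $H,J$ of $A_{k-1}$ by adding an edge $uv$, where $u$ and $v$ are vertices of maximum degree in $H$ and $J$, respectively. The trees $B_k$: for $k\ge 1$, $B_k=A_k+uz$, where $u$ is a vertex of maximum degree in $A_k$ and $z$ is a new vertex. (Both are well defined up to isomorphism, since vertices of maximum degree in $A_k$ are equivalent under automorphisms.) Graphs are finite and simple. $S_X$ is the symmetric group on a finite set $X$, $S_n=S_{\{1,\dots,n\}}$. A labeling of a graph $G$ with vertex set $V$ is a bijection $\lambda:V\to X$; write $v_x=\lambda^{-1}(x)$ and $L_G=\{ij : v_iv_j\in E(G)\}$ (no distinction between $ij$ and $ji$). For $\sigma\in S_X$, $G_\sigma$ is the graph on $V$ with edge set $\{v_iv_j : \sigma(i)\sigma(j)\in L_G\}$. A feasible edge-replacement $rs\to kl$ is given by an edge $v_rv_s\in E(G)$ and a non-edge $v_kv_l\in E(\overline G)$ with $G-v_rv_s+v_kv_l\cong G$; the neutral replacement $\emptyset\to\emptyset$ is also considered feasible. $R_G$ is the set of all feasible edge-replacements. Put $\mathrm{Fer}_G(rs\to kl)=\{\sigma\in S_X : G_\sigma=G-v_rv_s+v_kv_l\}$, $\mathrm{Fer}_G(\emptyset\to\emptyset)=\{\sigma\in S_X : G_\sigma=G\}$, and let $\mathrm{Fer}(G)\le S_X$ be the group generated by $\bigcup_{e\to e'\in R_G}\mathrm{Fer}_G(e\to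 e')$. A graph $G$ of order $n$ is a local amoeba if $\mathrm{Fer}(G)\cong S_n$, and a global amoeba if $\mathrm{Fer}(G\cup K_1)\cong S_{n+1}$, where $G\cup K_1$ is $G$ plus an isolated vertex. *)

theory Defs
  imports "HOL-Algebra.Sym_Groups" "HOL-Algebra.Elementary_Groups"
begin

section \<open>Finite simple graphs\<close>

record 'a sgraph =
  verts :: "'a set"
  edges :: "'a set set"

definition simple_graph :: "'a sgraph \<Rightarrow> bool" where
  "simple_graph G \<longleftrightarrow> finite (verts G) \<and> edges G \<subseteq> {e. e \<subseteq> verts G \<and> card e = 2}"

definition graph_iso :: "'a sgraph \<Rightarrow> 'b sgraph \<Rightarrow> bool" where
  "graph_iso G H \<longleftrightarrow>
     (\<exists>f. bij_betw f (verts G) (verts H) \<and>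
          (\<forall>u\<in>verts G. \<forall>v\<in>verts G. {u, v} \<in> edges G \<longleftrightarrow> {f u, f v} \<in> edges H))"

definition vdegree :: "'a sgraph \<Rightarrow> 'a \<Rightarrow> nat" where
  "vdegree G v = card {e \<in> edges G. v \<in> e}"

definition max_degree_vertex :: "'a sgraph \<Rightarrow> 'a \<Rightarrow> bool" where
  "max_degree_vertex G v \<longleftrightarrow> v \<in> verts G \<and> (\<forall>w\<in>verts G. vdegree G w \<le> vdegree G v)"

text \<open>The added vertex is \<open>None\<close>, so that a new vertex exists for every vertex type.\<close>

definition add_K1 :: "'a sgraph \<Rightarrow> 'a option sgraph" where
  "add_K1 G = \<lparr>verts = insert None (Some ` verts G), edges = image Some ` edges G\<rparr>"


section \<open>The trees \<open>A\<^sub>k\<close> and \<open>B\<^sub>k\<close>\<close>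

text \<open>
  \<open>is_A k G\<close> says that \<open>G\<close> is a copy of \<open>A\<^sub>k\<close> on vertices of the given type.  All
  choices of disjoint copies and of vertices of maximum degree are allowed.
\<close>

inductive is_A :: "nat \<Rightarrow> 'a sgraph \<Rightarrow> bool" where
  one: "is_A 1 \<lparr>verts = {v}, edges = {}\<rparr>"
| step: "\<lbrakk>k \<ge> 2; is_A (k - 1) H; is_A (k - 1) J; verts H \<inter> verts J = {};
          max_degree_vertex H u; max_degree_vertex J v\<rbrakk>
         \<Longrightarrow> is_A k \<lparr>verts = verts H \<union> verts J, edges = edges H \<union> edges J \<union> {{u, v}}\<rparr>"

definition is_B :: "nat \<Rightarrow> 'a sgraph \<Rightarrow> bool" where
  "is_B k G \<longleftrightarrow>
     (\<exists>H u z. is_A k H \<and> max_degree_vertex H u \<and> z \<notin> verts H \<and>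
              G = \<lparr>verts = insert z (verts H), edges = insert {u, z} (edges H)\<rparr>)"


section \<open>Labelings and feasible edge-replacements\<close>

text \<open>The symmetric group \<open>S\<^sub>X\<close>, following the library's \<open>sym_group\<close>.\<close>

definition sym_group_on :: "'b set \<Rightarrow> ('b \<Rightarrow> 'b) monoid" where
  "sym_group_on X = \<lparr>carrier = {p. p permutes X}, mult = (\<circ>), one = id\<rparr>"

definition labeling :: "'a sgraph \<Rightarrow> ('a \<Rightarrow> 'b) \<Rightarrow> 'b set \<Rightarrow> bool" where
  "labeling G lab X \<longleftrightarrow> bij_betw lab (verts G) X"

text \<open>\<open>vertex_of G lab x\<close> is the vertex \<open>v\<^sub>x\<close>; it is meaningful for labels \<open>x\<close> of \<open>G\<close> only.\<close>

definition vertex_of :: "'a sgraph \<Rightarrow> ('a \<Rightarrow> 'b) \<Rightarrow> 'b \<Rightarrow> 'a" where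
  "vertex_of G lab = inv_into (verts G) lab"

definition label_edges :: "'a sgraph \<Rightarrow> ('a \<Rightarrow> 'b) \<Rightarrow> 'b set \<Rightarrow> 'b set set" where
  "label_edges G lab X =
     {{i, j} |i j. i \<in> X \<and> j \<in> X \<and> {vertex_of G lab i, vertex_of G lab j} \<in> edges G}"

definition permuted_graph :: "'a sgraph \<Rightarrow> ('a \<Rightarrow> 'b) \<Rightarrow> 'b set \<Rightarrow> ('b \<Rightarrow> 'b) \<Rightarrow> 'a sgraph" where
  "permuted_graph G lab X \<sigma> =
     \<lparr>verts = verts G,
      edges = {{vertex_of G lab i, vertex_of G lab j} |i j.
                 i \<in> X \<and> j \<in> X \<and> {\<sigma> i, \<sigma> j} \<in> label_edges G lab X}\<rparr>"

text \<open>
  \<open>Replace e e'\<close> is the replacement of \<open>e = {r, s}\<close> by \<open>e' = {k, l}\<close> (label pairs), and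
  \<open>Neutral\<close> is the replacement of nothing by nothing.
\<close>

datatype 'b replacement = Neutral | Replace "'b set" "'b set"

fun apply_replacement :: "'a sgraph \<Rightarrow> ('a \<Rightarrow> 'b) \<Rightarrow> 'b replacement \<Rightarrow> 'a sgraph" where
  "apply_replacement G lab Neutral = G"
| "apply_replacement G lab (Replace e e') =
     G\<lparr>edges := (edges G - {vertex_of G lab ` e}) \<union> {vertex_of G lab ` e'}\<rparr>"

definition feasible_replacements :: "'a sgraph \<Rightarrow> ('a \<Rightarrow> 'b) \<Rightarrow> 'b set \<Rightarrow> 'b replacement set" where
  "feasible_replacements G lab X =
     insert Neutral
       {Replace {r, s} {k, l} |r s k l.
          r \<in> X \<and> s \<in> X \<and> k \<in> X \<and> l \<in> X \<and>
          {vertex_of G lab r, vertex_of G lab s} \<in> edges G \<and>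
          k \<noteq> l \<and> {vertex_of G lab k, vertex_of G lab l} \<notin> edges G \<and>
          graph_iso (apply_replacement G lab (Replace {r, s} {k, l})) G}"

definition Fer_replacement ::
    "'a sgraph \<Rightarrow> ('a \<Rightarrow> 'b) \<Rightarrow> 'b set \<Rightarrow> 'b replacement \<Rightarrow> ('b \<Rightarrow> 'b) set" where
  "Fer_replacement G lab X \<rho> =
     {\<sigma> \<in> carrier (sym_group_on X). permuted_graph G lab X \<sigma> = apply_replacement G lab \<rho>}"

definition Fer :: "'a sgraph \<Rightarrow> ('a \<Rightarrow> 'b) \<Rightarrow> 'b set \<Rightarrow> ('b \<Rightarrow> 'b) monoid" where
  "Fer G lab X =
     subgroup_generated (sym_group_on X)
       (\<Union>\<rho>\<in>feasible_replacements G lab X. Fer_replacement G lab X \<rho>)"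


section \<open>Amoebas\<close>

text \<open>
  Up to isomorphism the group does not depend on the labeling; the definitions quantify
  over all labelings by natural numbers.
\<close>

definition local_amoeba :: "'a sgraph \<Rightarrow> bool" where
  "local_amoeba G \<longleftrightarrow>
     simple_graph G \<and>
     (\<forall>(lab :: 'a \<Rightarrow> nat) X. labeling G lab X \<longrightarrow> Fer G lab X \<cong> sym_group (card (verts G)))"

definition global_amoeba :: "'a sgraph \<Rightarrow> bool" where
  "global_amoeba G \<longleftrightarrow>
     simple_graph G \<and>
     (\<forall>(lab :: 'a option \<Rightarrow> nat) X. labeling (add_K1 G) lab X \<longrightarrow>
        Fer (add_K1 G) lab X \<cong> sym_group (card (verts G) + 1))"


section \<open>Existence of the trees\<close>

lemma sym_group_on_atLeastAtMost: "sym_group_on {1..n} = sym_group n"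
  by (simp add: sym_group_on_def sym_group_def)

lemma ex_labeling:
  assumes "simple_graph G"
  shows "\<exists>(lab :: 'a \<Rightarrow> nat). labeling (G :: 'a sgraph) lab {1..card (verts G)}"
  using assms finite_same_card_bij[of "verts G" "{1..card (verts G)}"]
  by (auto simp: labeling_def simple_graph_def)

lemma is_A_finite_nonempty: "is_A k G \<Longrightarrow> finite (verts G) \<and> verts G \<noteq> {}"
  by (induction rule: is_A.induct) auto

lemma is_A_simple_graph: "is_A k G \<Longrightarrow> simple_graph G"
proof (induction rule: is_A.induct)
  case (one v)
  then show ?case by (simp add: simple_graph_def)
next
  case (step k H J u v)
  then have "u \<noteq> v" by (auto simp: max_degree_vertex_def)
  with step show ?case by (auto simp: simple_graph_def max_degree_vertex_def)
qed

lemma ex_max_degree_vertex: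
  assumes "is_A k G"
  shows "\<exists>u. max_degree_vertex G u"
proof -
  have fin: "finite (vdegree G ` verts G)" and ne: "vdegree G ` verts G \<noteq> {}"
    using is_A_finite_nonempty[OF assms] by auto
  obtain u where "u \<in> verts G" "vdegree G u = Max (vdegree G ` verts G)"
    using Max_in[OF fin ne] by auto
  then show ?thesis
    using Max_ge[OF fin] unfolding max_degree_vertex_def by (metis imageI)
qed

lemma ex_is_A_within:
  assumes "k \<ge> 1" "infinite S"
  shows "\<exists>G. is_A k G \<and> verts G \<subseteq> S"
  using assms
proof (induction k arbitrary: S rule: dec_induct)
  case base
  then obtain v where "v \<in> S" using infinite_imp_nonempty by auto
  then have "verts \<lparr>verts = {v}, edges = {}\<rparr> \<subseteq> S" by simp
  with is_A.one[of v] show ?case by (intro exI conjI)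
next
  case (step k)
  from step.IH[OF \<open>infinite S\<close>] obtain H where H: "is_A k H" "verts H \<subseteq> S" by blast
  have "infinite (S - verts H)"
    using step.prems is_A_finite_nonempty[OF H(1)] by simp
  from step.IH[OF this] obtain J where J: "is_A k J" "verts J \<subseteq> S - verts H" by blast
  obtain u v where "max_degree_vertex H u" "max_degree_vertex J v"
    using ex_max_degree_vertex H(1) J(1) by blast
  then have "is_A (Suc k) \<lparr>verts = verts H \<union> verts J, edges = edges H \<union> edges J \<union> {{u, v}}\<rparr>"
    using H J step.hyps by (intro is_A.step) auto
  moreover have "verts \<lparr>verts = verts H \<union> verts J, edges = edges H \<union> edges J \<union> {{u, v}}\<rparr> \<subseteq> S"
    using H(2) J(2) by auto
  ultimately show ?case by (intro exI conjI)
qed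

lemma ex_is_A:
  assumes "k \<ge> 1" "infinite (UNIV :: 'a set)"
  shows "\<exists>G :: 'a sgraph. is_A k G"
  using ex_is_A_within[OF assms] by blast

lemma ex_is_B:
  assumes "k \<ge> 1" "infinite (UNIV :: 'a set)"
  shows "\<exists>G :: 'a sgraph. is_B k G"
proof -
  obtain H :: "'a sgraph" where H: "is_A k H" using ex_is_A[OF assms] by blast
  obtain z where "z \<notin> verts H"
    using is_A_finite_nonempty[OF H] assms(2) ex_new_if_finite by blast
  then show ?thesis
    using H ex_max_degree_vertex[OF H] unfolding is_B_def by blast
qed

end

theory Submission
  imports Defs
begin

text \<open>
  Transport a graph to its labels and let \<open>L\<close> be its edge set there. A permutation \<open>p\<close> of the labels
  belongs (up to inversion) to one of the sets generating \<open>Fer\<close> exactly if \<open>p\<close> carries \<open>L\<close> to \<open>L\<close>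
  with at most one edge replaced: the new graph is then automatically isomorphic to the old one,
  with \<open>p\<close> as the isomorphism. So a graph is a local amoeba as soon as these ``near-automorphisms''
  generate all permutations (\<open>Fer_iso_sym_group\<close>), and a global amoeba as soon as they do so
  in the presence of an extra isolated vertex.

  The tree \<open>A\<^sub>k\<close> is the binomial tree of order \<open>k - 1\<close>, and its vertices of maximum degree are its
  possible roots (\<open>max_degree_vertex_binomial_root\<close>): two copies of the tree of order \<open>n\<close>, with roots
  \<open>u\<close> and \<open>v\<close>, are joined by the edge \<open>uv\<close>, and for \<open>n > 0\<close> each copy has a second root \<open>u'\<close>, \<open>v'\<close>
  equivalent to the first. The heart of the proof (\<open>binomial_tree_linked_off_root\<close>) is the stronger,
  inductive claim that the near-automorphisms fixing the root \<open>u\<close> already generate all permutations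
  of the other vertices. Those of the \<open>u\<close>-copy fixing \<open>u\<close> and those of the \<open>v\<close>-copy fixing \<open>v\<close>
  remain near-automorphisms of the whole tree, since they do not touch the edge \<open>uv\<close>. They are tied
  together by two more moves. An automorphism of the \<open>v\<close>-copy taking \<open>v\<close> to \<open>v'\<close> replaces only the
  edge \<open>uv\<close>, by \<open>uv'\<close>. Finally, split both copies into halves: interchanging the half rooted at \<open>u'\<close>
  with the half rooted at \<open>v\<close> preserves \<open>{uv, uu'}\<close> and replaces only \<open>vv'\<close>, by \<open>u'v'\<close>; this carries
  vertices of one copy to the other.

  An automorphism moving the root then gives all permutations of \<open>A\<^sub>k\<close>. A further vertex, either
  isolated or pendant at the root, is reached by exchanging it with a leaf at the root, because
  this exchange replaces at most one edge. This yields \<open>B\<^sub>k\<close> and both global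
  statements.

  Group generation is handled through transpositions: whether the transposition of two points
  is generated is an equivalence relation invariant under the generators, so the argument only
  has to merge its classes.
\<close>

section \<open>Groups generated by permutations, seen through transpositions\<close>

inductive_set perm_span :: "('a \<Rightarrow> 'a) set \<Rightarrow> ('a \<Rightarrow> 'a) set" for S where
  gen: "p \<in> S \<Longrightarrow> p \<in> perm_span S"
| ident: "id \<in> perm_span S"
| comp: "p \<in> perm_span S \<Longrightarrow> q \<in> perm_span S \<Longrightarrow> p \<circ> q \<in> perm_span S"
| inverse: "p \<in> S \<Longrightarrow> inv' p \<in> perm_span S"

text \<open>
  For finite \<open>A\<close> this says that every permutation of \<open>A\<close> is generated, but in a form that
  makes it a statement about the classes of an equivalence relation on points.
\<close>

definition linked :: "('a \<Rightarrow> 'a) set \<Rightarrow> 'a set \<Rightarrow> bool" where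
  "linked S A \<longleftrightarrow> (\<forall>x\<in>A. \<forall>y\<in>A. transpose x y \<in> perm_span S)"

lemma perm_span_mono: "S \<subseteq> T \<Longrightarrow> perm_span S \<subseteq> perm_span T"
proof
  fix p assume "S \<subseteq> T" "p \<in> perm_span S"
  from this(2,1) show "p \<in> perm_span T"
    by (induction rule: perm_span.induct) (auto intro: perm_span.intros)
qed

lemma linked_mono: "linked S A \<Longrightarrow> S \<subseteq> T \<Longrightarrow> linked T A"
  using perm_span_mono unfolding linked_def by blast

lemma linked_subset: "linked S A \<Longrightarrow> B \<subseteq> A \<Longrightarrow> linked S B"
  unfolding linked_def by blast

lemma linked_singleton: "linked S {a}"
  by (simp add: linked_def perm_span.ident)

lemma transpose_span_trans:
  assumes "transpose x y \<in> perm_span S" "transpose y z \<in> perm_span S"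
  shows "transpose x z \<in> perm_span S"
proof (cases "x = y \<or> y = z \<or> x = z")
  case True
  then show ?thesis using assms by (auto simp: perm_span.ident)
next
  case False
  then have "transpose x y \<circ> transpose y z \<circ> transpose x y = transpose x z"
    by (intro transpose_comp_triple) auto
  then show ?thesis using assms perm_span.comp by metis
qed

lemma linked_Un:
  assumes "linked S A" "linked S B" "a \<in> A" "b \<in> B" "transpose a b \<in> perm_span S"
  shows "linked S (A \<union> B)"
proof -
  have "transpose a x \<in> perm_span S" if "x \<in> A \<union> B" for x
    using that assms transpose_span_trans[of a b S x] unfolding linked_def by blast
  then show ?thesis
    unfolding linked_def using transpose_span_trans[of _ a S] by (metis transpose_commute)
qed

lemma linked_insert:
  assumes "linked S A" "a \<in> A" "transpose a b \<in> perm_span S"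
  shows "linked S (insert b A)"
  using linked_Un[OF assms(1) linked_singleton[of S b] assms(2) _ assms(3)] by simp

lemma linked_Un_overlap:
  assumes "linked S A" "linked S B" "a \<in> A" "a \<in> B"
  shows "linked S (A \<union> B)"
  using assms by (intro linked_Un[where a = a and b = a]) (auto simp: perm_span.ident)

lemma linked_image:
  assumes "linked S A" "p \<in> S" "bij p"
  shows "linked S (p ` A)"
proof -
  have "transpose (p x) (p y) \<in> perm_span S" if "x \<in> A" "y \<in> A" for x y
  proof -
    have "transpose (p x) (p y) = p \<circ> transpose x y \<circ> inv' p"
      using assms(3) by (auto simp: fun_eq_iff transpose_def bij_is_inj inv_f_f bij_is_surj surj_f_inv_f)
    then show ?thesis
      using assms(1,2) that unfolding linked_def
      by (simp add: perm_span.comp perm_span.gen perm_span.inverse)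
  qed
  then show ?thesis unfolding linked_def by blast
qed

text \<open>
  A point stabilizer in a symmetric group is a maximal subgroup. In terms of classes: \<open>p\<close> carries
  the class \<open>A - {a}\<close> onto \<open>A - {p a}\<close>, and the two overlap unless \<open>A\<close> has only two points, in which
  case \<open>p\<close> itself is the missing transposition.
\<close>

lemma linked_if_moves:
  assumes "linked S (A - {a})" "p \<in> S" "p permutes A" "a \<in> A" "p a \<noteq> a"
  shows "linked S A"
proof -
  have pa: "p a \<in> A" using assms by (simp add: permutes_in_image)
  show ?thesis
  proof (cases "\<exists>y\<in>A. y \<noteq> a \<and> y \<noteq> p a")
    case True
    then obtain y where y: "y \<in> A" "y \<noteq> a" "y \<noteq> p a" by blast
    have "p ` (A - {a}) = A - {p a}"
      using assms(3) by (simp add: image_set_diff permutes_inj permutes_image)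
    then have "linked S (A - {p a})"
      using linked_image[OF assms(1,2) permutes_bij[OF assms(3)]] by simp
    from linked_Un_overlap[OF assms(1) this, of y] y
    have "linked S ((A - {a}) \<union> (A - {p a}))" by blast
    then show ?thesis by (rule linked_subset) (use assms(5) in auto)
  next
    case False
    then have A: "A = {a, p a}" using assms(4) pa by blast
    have "p (p a) \<noteq> p a" using assms(3,5) by (metis permutes_inj injD)
    moreover have "p (p a) \<in> A" using pa assms(3) by (simp add: permutes_in_image)
    ultimately have "p (p a) = a" using A by blast
    then have "p = transpose a (p a)"
      using A permutes_not_in[OF assms(3)] by (auto simp: fun_eq_iff transpose_def)
    then have "transpose a (p a) \<in> perm_span S"
      using assms(2) perm_span.gen by metis
    from linked_insert[OF linked_singleton _ this] show ?thesis
      using A by (simp add: insert_commute)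
  qed
qed

lemma linked_imp_permutes_in_span:
  assumes "finite X" "linked S X" "p permutes X"
  shows "p \<in> perm_span S"
  using assms(3,1)
proof (induction rule: permutes_induct)
  case id
  show ?case by (rule perm_span.ident)
next
  case (swap a b p)
  then have "transpose a b \<in> perm_span S" using assms(2) unfolding linked_def by blast
  then show ?case using swap by (intro perm_span.comp)
qed

section \<open>Permutations replacing at most one edge\<close>

text \<open>
  If \<open>E\<close> is finite, the image of \<open>E\<close> has as many edges as \<open>E\<close>, so the inclusion says that the image
  is \<open>E\<close> or arises from \<open>E\<close> by replacing a single edge. The set \<open>P\<close> of points that may move is
  independent of \<open>E\<close>: omitting a vertex of the graph from it expresses that this vertex is fixed,
  and additional points serve as isolated vertices.
\<close>

definition near_auts :: "'a set \<Rightarrow> 'a set set \<Rightarrow> ('a \<Rightarrow> 'a) set" where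
  "near_auts P E = {p. p permutes P \<and> (\<exists>e. image p ` E \<subseteq> insert e E)}"

lemma near_autsI: "p permutes P \<Longrightarrow> image p ` E \<subseteq> insert e E \<Longrightarrow> p \<in> near_auts P E"
  by (auto simp: near_auts_def)

text \<open>
  Edges avoiding all movable points are not replaced; this embeds the
  near-automorphisms of a rooted subtree fixing its root into those of the whole tree.
\<close>

lemma near_auts_mono:
  assumes "P \<subseteq> Q" "\<And>f. f \<in> F \<Longrightarrow> f \<inter> P = {}"
  shows "near_auts P E \<subseteq> near_auts Q (E \<union> F)"
proof
  fix p assume "p \<in> near_auts P E"
  then obtain e where p: "p permutes P" "image p ` E \<subseteq> insert e E"
    by (auto simp: near_auts_def)
  have "p ` f = f" if "f \<in> F" for f
  proof -
    have "p x = x" if "x \<in> f" for x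
      using assms(2)[OF \<open>f \<in> F\<close>] that permutes_not_in[OF p(1)] by blast
    then show ?thesis by simp
  qed
  then have "image p ` (E \<union> F) \<subseteq> insert e (E \<union> F)" using p(2) by auto
  then show "p \<in> near_auts Q (E \<union> F)"
    using permutes_subset[OF p(1) assms(1)] by (auto simp: near_auts_def)
qed

text \<open>
  This covers two uses of a leaf \<open>l\<close> at \<open>c\<close>: if \<open>w\<close> is another leaf at \<open>c\<close> the transposition is an
  automorphism, and if \<open>w\<close> is isolated it replaces \<open>cl\<close> by \<open>cw\<close>.
\<close>

lemma transpose_pendant_near_aut:
  assumes "l \<in> P" "w \<in> P" "c \<noteq> l" "c \<noteq> w"
    and "\<And>e. e \<in> E \<Longrightarrow> l \<in> e \<or> w \<in> e \<Longrightarrow> e = {c, l} \<or> e = {c, w}"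
    and "{c, l} \<in> E"
  shows "transpose l w \<in> near_auts P E"
proof (rule near_autsI[where e = "{c, w}"])
  show "transpose l w permutes P" using assms by (simp add: permutes_swap_id)
  have "transpose l w ` e \<in> insert {c, w} E" if "e \<in> E" for e
  proof (cases "l \<in> e \<or> w \<in> e")
    case True
    then have "e = {c, l} \<or> e = {c, w}" using assms(5) that by blast
    then show ?thesis using assms(3,4,6) by auto
  next
    case False
    then show ?thesis using that by simp
  qed
  then show "image (transpose l w) ` E \<subseteq> insert {c, w} E" by blast
qed

section \<open>Binomial trees\<close>

text \<open>
  The root is part of the data because the central induction is about permutations fixing it.
\<close>

inductive binomial_tree :: "nat \<Rightarrow> 'a set \<Rightarrow> 'a set set \<Rightarrow> 'a \<Rightarrow> bool" where
  single: "binomial_tree 0 {u} {} u"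
| link: "binomial_tree n V E u \<Longrightarrow> binomial_tree n W F v \<Longrightarrow> V \<inter> W = {} \<Longrightarrow>
    binomial_tree (Suc n) (V \<union> W) (insert {u, v} (E \<union> F)) u"

inductive_simps binomial_tree_0: "binomial_tree 0 V E u"

inductive_cases binomial_tree_SucE: "binomial_tree (Suc n) V E u"

lemma binomial_tree_root: "binomial_tree n V E u \<Longrightarrow> u \<in> V"
  by (induction rule: binomial_tree.induct) auto

lemma binomial_tree_edge: "binomial_tree n V E u \<Longrightarrow> e \<in> E \<Longrightarrow> e \<subseteq> V"
  by (induction rule: binomial_tree.induct) (auto dest: binomial_tree_root)

lemma binomial_tree_image:
  "binomial_tree n V E u \<Longrightarrow> inj_on f V \<Longrightarrow> binomial_tree n (f ` V) (image f ` E) (f u)"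
proof (induction rule: binomial_tree.induct)
  case (single u)
  show ?case by (simp add: binomial_tree.single)
next
  case (link n V E u W F v)
  then have "binomial_tree n (f ` V) (image f ` E) (f u)" "binomial_tree n (f ` W) (image f ` F) (f v)"
    by (simp_all add: inj_on_Un)
  moreover have "f ` V \<inter> f ` W = {}"
    using link.prems link.hyps(3) by (metis inj_on_image_Int sup_ge1 sup_ge2 image_empty)
  ultimately show ?case
    using binomial_tree.link[of n "f ` V" _ _ "f ` W"] by (simp add: image_Un)
qed

text \<open>
  The last linking step is symmetric in its two halves.
\<close>

lemma binomial_tree_other_root:
  assumes "binomial_tree n V E u" "n > 0"
  obtains v where "v \<noteq> u" "binomial_tree n V E v"
  using assms
proof (cases rule: binomial_tree.cases)
  case (link m V' E' W F v)
  then have "binomial_tree n V E v"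
    using binomial_tree.link[OF link(5,4)] by (simp add: Un_commute Int_commute insert_commute)
  moreover have "v \<noteq> u"
    using binomial_tree_root[OF link(4)] binomial_tree_root[OF link(5)] link(6) by blast
  ultimately show thesis using that by blast
qed simp

lemma binomial_tree_iso:
  assumes "binomial_tree n V E u" "binomial_tree n W F v"
  shows "\<exists>f. bij_betw f V W \<and> image f ` E = F \<and> f u = v"
  using assms
proof (induction arbitrary: W F v rule: binomial_tree.induct)
  case (single u)
  then have "W = {v} \<and> F = {}" by (simp add: binomial_tree_0)
  then show ?case by (intro exI[of _ "\<lambda>_. v"]) (simp add: bij_betw_def)
next
  case (link n V1 E1 u1 V2 E2 u2)
  from link.prems obtain W1 F1 W2 F2 v2 where W: "W = W1 \<union> W2" "F = insert {v, v2} (F1 \<union> F2)"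
    "binomial_tree n W1 F1 v" "binomial_tree n W2 F2 v2" "W1 \<inter> W2 = {}"
    by (auto elim: binomial_tree_SucE)
  obtain f where f: "bij_betw f V1 W1" "image f ` E1 = F1" "f u1 = v"
    using link.IH(1)[OF W(3)] by blast
  obtain g where g: "bij_betw g V2 W2" "image g ` E2 = F2" "g u2 = v2"
    using link.IH(2)[OF W(4)] by blast
  define h where "h x = (if x \<in> V1 then f x else g x)" for x
  have h1: "h x = f x" if "x \<in> V1" for x using that by (simp add: h_def)
  have h2: "h x = g x" if "x \<in> V2" for x using that link.hyps(3) by (auto simp: h_def)
  have "bij_betw h V1 W1" "bij_betw h V2 W2"
    using f(1) g(1) h1 h2 by (simp_all cong: bij_betw_cong)
  then have "bij_betw h (V1 \<union> V2) W"
    unfolding W(1) using W(5) by (rule bij_betw_combine)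
  moreover have "h ` e = f ` e" if "e \<in> E1" for e
    using binomial_tree_edge[OF link.hyps(1) that] h1 by (intro image_cong) auto
  moreover have "h ` e = g ` e" if "e \<in> E2" for e
    using binomial_tree_edge[OF link.hyps(2) that] h2 by (intro image_cong) auto
  moreover have "h u1 = v" "h u2 = v2"
    using f(3) g(3) h1 h2 binomial_tree_root[OF link.hyps(1)] binomial_tree_root[OF link.hyps(2)]
    by simp_all
  ultimately show ?case
    unfolding W(2) using f(2) g(2) by (intro exI[of _ h]) (auto simp: image_Un)
qed

lemma binomial_tree_automorphism:
  assumes "binomial_tree n V E u" "binomial_tree n V E v"
  obtains p where "p permutes V" "image p ` E = E" "p u = v"
proof -
  obtain f where f: "bij_betw f V V" "image f ` E = E" "f u = v"
    using binomial_tree_iso[OF assms] by blast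
  define p where "p x = (if x \<in> V then f x else x)" for x
  have "p permutes V"
    using f(1) by (intro bij_imp_permutes) (auto simp: p_def cong: bij_betw_cong)
  moreover have "image p ` E = image f ` E"
    using binomial_tree_edge[OF assms(1)] by (intro image_cong) (auto simp: p_def)
  moreover have "p u = v" using f(3) binomial_tree_root[OF assms(1)] by (simp add: p_def)
  ultimately show thesis using f(2) that by simp
qed

text \<open>
  The isomorphism between the trees and its inverse, put together, interchange them.
\<close>

lemma binomial_tree_exchange:
  assumes "binomial_tree n V E u" "binomial_tree n W F v" "V \<inter> W = {}"
  obtains p where "p permutes (V \<union> W)" "image p ` E = F" "image p ` F = E" "p u = v" "p v = u"
proof -
  obtain f where f: "bij_betw f V W" "image f ` E = F" "f u = v"
    using binomial_tree_iso[OF assms(1,2)] by blast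
  define g where "g = inv_into V f"
  have g: "bij_betw g W V" using f(1) by (simp add: g_def bij_betw_inv_into)
  have gf: "g (f x) = x" if "x \<in> V" for x
    using f(1) that by (simp add: g_def bij_betw_inv_into_left)
  define p where "p x = (if x \<in> V then f x else if x \<in> W then g x else x)" for x
  have pV: "p x = f x" if "x \<in> V" for x using that by (simp add: p_def)
  have pW: "p x = g x" if "x \<in> W" for x using that assms(3) by (auto simp: p_def)
  have "bij_betw p V W" "bij_betw p W V"
    using f(1) g pV pW by (simp_all cong: bij_betw_cong)
  then have "bij_betw p (V \<union> W) (W \<union> V)"
    using assms(3) by (intro bij_betw_combine) auto
  then have "p permutes (V \<union> W)"
    by (intro bij_imp_permutes) (auto simp: p_def Un_commute)
  moreover have EF: "image p ` E = F"
    unfolding f(2)[symmetric] using binomial_tree_edge[OF assms(1)] pV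
    by (intro image_cong refl) (meson subsetD)
  moreover have pp: "p (p x) = x" if "x \<in> V" for x
    using that pV pW gf f(1) by (simp add: bij_betw_apply)
  then have "p ` p ` e = e" if "e \<in> E" for e
    using binomial_tree_edge[OF assms(1) that] by (force simp: image_image)
  then have "image p ` F = E"
    unfolding EF[symmetric] by (simp add: image_image)
  moreover have "p u = v" using f(3) pV binomial_tree_root[OF assms(1)] by simp
  moreover from this have "p v = u" using pp[OF binomial_tree_root[OF assms(1)]] by simp
  ultimately show thesis using that by blast
qed

lemma binomial_tree_moving_automorphism:
  assumes "binomial_tree n V E u" "n > 0"
  obtains p where "p permutes V" "image p ` E = E" "p u \<noteq> u"
proof -
  obtain v where v: "v \<noteq> u" "binomial_tree n V E v"
    using binomial_tree_other_root[OF assms] by blast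
  obtain p where "p permutes V" "image p ` E = E" "p u = v"
    using binomial_tree_automorphism[OF assms(1) v(2)] by blast
  then show thesis using v(1) that by blast
qed

text \<open>
  The first linking step attaches a leaf to the root, and later steps leave that leaf untouched.
\<close>

lemma binomial_tree_root_leaf:
  assumes "binomial_tree n V E u" "n > 0"
  shows "\<exists>l\<in>V. l \<noteq> u \<and> {u, l} \<in> E \<and> (\<forall>e\<in>E. l \<in> e \<longrightarrow> e = {u, l})"
  using assms
proof (induction rule: binomial_tree.induct)
  case (link n V E u W F v)
  have uv: "u \<in> V" "v \<in> W"
    using link.hyps(1,2) by (blast intro: binomial_tree_root)+
  note EV = binomial_tree_edge[OF link.hyps(1)] and FW = binomial_tree_edge[OF link.hyps(2)]
  show ?case
  proof (cases "n = 0")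
    case True
    then have "E = {}" "F = {}" using link.hyps(1,2) by (simp_all add: binomial_tree_0)
    moreover have "v \<noteq> u" using uv link.hyps(3) by blast
    ultimately show ?thesis
      using uv \<open>E = {}\<close> \<open>F = {}\<close> by (intro bexI[of _ v] conjI) simp_all
  next
    case False
    then have "0 < n" by simp
    from link.IH(1)[OF this] obtain l
      where l: "l \<in> V" "l \<noteq> u" "{u, l} \<in> E" and El: "\<forall>e\<in>E. l \<in> e \<longrightarrow> e = {u, l}"
      by (elim bexE conjE)
    have "l \<notin> W" using l(1) link.hyps(3) by blast
    have only: "e = {u, l}" if e: "e \<in> insert {u, v} (E \<union> F)" "l \<in> e" for e
    proof -
      have "e \<notin> F" using FW[of e] e(2) \<open>l \<notin> W\<close> by blast
      moreover have "e \<noteq> {u, v}" using e(2) l(2) uv(2) \<open>l \<notin> W\<close> by auto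
      ultimately have "e \<in> E" using e(1) by simp
      from bspec[OF El this] e(2) show ?thesis by (rule mp)
    qed
    show ?thesis
    proof (intro bexI conjI ballI impI)
      show "l \<in> V \<union> W" "l \<noteq> u" "{u, l} \<in> insert {u, v} (E \<union> F)" using l(1-3) by simp_all
    qed (rule only)
  qed
qed simp

section \<open>Linking the vertices of binomial trees\<close>

text \<open>
  Fixing the root is what makes the induction work: a permutation moving the root of a subtree
  would in general replace the edge leading out of the subtree in addition to one edge inside it.
\<close>

lemma binomial_tree_linked_off_root:
  assumes "binomial_tree n V E u"
  shows "linked (near_auts (V - {u}) E) (V - {u})"
  using assms
proof (induction rule: binomial_tree.induct)
  case (single u)
  show ?case by (simp add: linked_def)
next
  case (link n V E u W F v)
  define D where "D = insert {u, v} (E \<union> F)"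
  define S where "S = near_auts (V \<union> W - {u}) D"
  have uv: "u \<in> V" "v \<in> W" "u \<notin> W" "v \<notin> V"
    using binomial_tree_root[OF link.hyps(1)] binomial_tree_root[OF link.hyps(2)] link.hyps(3) by blast+
  note EV = binomial_tree_edge[OF link.hyps(1)] and FW = binomial_tree_edge[OF link.hyps(2)]
  have "near_auts (V - {u}) E \<subseteq> near_auts (V \<union> W - {u}) (E \<union> insert {u, v} F)"
    using FW link.hyps(3) uv by (intro near_auts_mono) blast+
  then have SV: "linked S (V - {u})"
    using linked_mono[OF link.IH(1)] by (simp add: S_def D_def)
  have "near_auts (W - {v}) F \<subseteq> near_auts (V \<union> W - {u}) (F \<union> insert {u, v} E)"
    using EV link.hyps(3) uv by (intro near_auts_mono) blast+
  then have SW: "linked S (W - {v})"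
    using linked_mono[OF link.IH(2)] by (simp add: S_def D_def Un_commute)
  show ?case
  proof (cases n)
    case 0
    then have "V = {u}" "W = {v}" using link.hyps(1,2) by (simp_all add: binomial_tree_0)
    then show ?thesis using uv by (simp add: linked_def perm_span.ident insert_Diff_if)
  next
    case (Suc m)
    \<comment> \<open>This automorphism of the second half replaces only the joining edge, by \<open>{u, p v}\<close>.\<close>
    obtain p where p: "p permutes W" "image p ` F = F" "p v \<noteq> v"
      using binomial_tree_moving_automorphism[OF link.hyps(2)] Suc by blast
    have pE: "p ` e = e" if "e \<in> E" for e
    proof -
      have "p x = x" if "x \<in> e" for x
        using EV[OF \<open>e \<in> E\<close>] that link.hyps(3) permutes_not_in[OF p(1)] by blast
      then show ?thesis by simp
    qed
    have "p u = u" using uv permutes_not_in[OF p(1)] by simp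
    then have "image p ` D \<subseteq> insert {u, p v} D" using p(2) pE by (auto simp: D_def)
    moreover have "p permutes (V \<union> W - {u})"
      using uv by (intro permutes_subset[OF p(1)]) blast
    ultimately have "p \<in> S" unfolding S_def by (rule near_autsI[rotated])
    then have SW': "linked S W"
      using linked_if_moves[OF SW _ p(1) uv(2) p(3)] by blast

    \<comment> \<open>Interchanging the quarter \<open>V2\<close> with the quarter \<open>W1\<close> replaces only \<open>{v, v'}\<close>, by \<open>{u', v'}\<close>.\<close>
    from link.hyps(1) Suc obtain V1 E1 V2 E2 u' where V: "V = V1 \<union> V2"
      "E = insert {u, u'} (E1 \<union> E2)" "binomial_tree m V1 E1 u" "binomial_tree m V2 E2 u'" "V1 \<inter> V2 = {}"
      by (auto elim: binomial_tree_SucE)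
    from link.hyps(2) Suc obtain W1 F1 W2 F2 v' where W: "W = W1 \<union> W2"
      "F = insert {v, v'} (F1 \<union> F2)" "binomial_tree m W1 F1 v" "binomial_tree m W2 F2 v'" "W1 \<inter> W2 = {}"
      by (auto elim: binomial_tree_SucE)
    have disj: "V2 \<inter> W1 = {}" using V(1) W(1) link.hyps(3) by blast
    obtain q where q: "q permutes (V2 \<union> W1)" "image q ` E2 = F1" "image q ` F1 = E2" "q u' = v" "q v = u'"
      using binomial_tree_exchange[OF V(4) W(3) disj] by blast
    have fixed: "q x = x" if "x \<in> V1 \<union> W2" for x
      using that V(1,5) W(1,5) link.hyps(3) by (intro permutes_not_in[OF q(1)]) blast
    have "q ` e = e" if "e \<in> E1 \<union> F2" for e
    proof -
      have "e \<subseteq> V1 \<union> W2"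
        using that binomial_tree_edge[OF V(3)] binomial_tree_edge[OF W(4)] by blast
      then have "q x = x" if "x \<in> e" for x using fixed that by blast
      then show ?thesis by simp
    qed
    then have qEF: "image q ` (E1 \<union> F2) = E1 \<union> F2" by simp
    have roots: "u \<in> V1" "u' \<in> V2" "v \<in> W1" "v' \<in> W2"
      using V(3,4) W(3,4) by (blast intro: binomial_tree_root)+
    then have "q u = u" "q v' = v'" using fixed by auto
    have D: "D = {{u, v}, {u, u'}, {v, v'}} \<union> (E1 \<union> F2) \<union> E2 \<union> F1"
      unfolding D_def V(2) W(2) by blast
    have "image q ` D = {{u, u'}, {u, v}, {u', v'}} \<union> (E1 \<union> F2) \<union> F1 \<union> E2"
      unfolding D image_Un qEF[unfolded image_Un] q(2,3)
      using q(4,5) \<open>q u = u\<close> \<open>q v' = v'\<close> by simp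
    also have "\<dots> \<subseteq> insert {u', v'} D" unfolding D by blast
    finally have "image q ` D \<subseteq> insert {u', v'} D" .
    moreover have "q permutes (V \<union> W - {u})"
      using roots V W uv by (intro permutes_subset[OF q(1)]) blast
    ultimately have "q \<in> S" unfolding S_def by (rule near_autsI[rotated])
    \<comment> \<open>The class \<open>q ` W\<close> meets \<open>V - {u}\<close> in \<open>u'\<close> and \<open>W\<close> in \<open>v'\<close>, so it merges the two.\<close>
    then have "linked S (q ` W)" using linked_image[OF SW' _ permutes_bij[OF q(1)]] by blast
    moreover have "u' \<in> q ` W" using q(5) uv by (metis imageI)
    moreover have "v' \<in> q ` W" "v' \<in> W"
      using \<open>q v' = v'\<close> roots W(1) by (metis imageI UnI2)+
    moreover have "u' \<in> V - {u}" using roots V by blast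
    ultimately have "linked S ((V - {u}) \<union> q ` W \<union> W)"
      using SV SW' by (meson linked_Un_overlap UnI1 UnI2)
    then show ?thesis
      unfolding S_def D_def by (rule linked_subset) (use uv in auto)
  qed
qed

lemma binomial_tree_linked:
  assumes "binomial_tree n V E u"
  shows "linked (near_auts V E) V"
proof (cases "n = 0")
  case True
  then show ?thesis using assms by (simp add: binomial_tree_0 linked_singleton)
next
  case False
  have "near_auts (V - {u}) E \<subseteq> near_auts V (E \<union> {})" by (intro near_auts_mono) auto
  then have "linked (near_auts V E) (V - {u})"
    using linked_mono[OF binomial_tree_linked_off_root[OF assms]] by simp
  moreover obtain p where p: "p permutes V" "image p ` E = E" "p u \<noteq> u"
    using binomial_tree_moving_automorphism[OF assms] False by blast
  moreover have "p \<in> near_auts V E" using p by (intro near_autsI) auto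
  ultimately show ?thesis
    using linked_if_moves binomial_tree_root[OF assms] by metis
qed

text \<open>
  The leaf \<open>l\<close> at \<open>c\<close> can be moved to the isolated vertex \<open>w\<close> at the cost of the single edge \<open>cl\<close>.
\<close>

lemma linked_insert_isolated:
  assumes "linked (near_auts V E) V" "\<And>e. e \<in> E \<Longrightarrow> e \<subseteq> V" "w \<notin> V"
    and "l \<in> V" "c \<in> V" "c \<noteq> l" "{c, l} \<in> E" "\<And>e. e \<in> E \<Longrightarrow> l \<in> e \<Longrightarrow> e = {c, l}"
  shows "linked (near_auts (insert w V) E) (insert w V)"
proof -
  have "near_auts V E \<subseteq> near_auts (insert w V) (E \<union> {})" by (intro near_auts_mono) auto
  then have "linked (near_auts (insert w V) E) V" using linked_mono[OF assms(1)] by simp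
  moreover have "transpose l w \<in> near_auts (insert w V) E"
  proof (rule transpose_pendant_near_aut)
    show "e = {c, l} \<or> e = {c, w}" if "e \<in> E" "l \<in> e \<or> w \<in> e" for e
    proof -
      have "w \<notin> e" using assms(2)[OF that(1)] assms(3) by blast
      then show ?thesis using assms(8)[OF that(1)] that(2) by blast
    qed
  qed (use assms(3-7) in auto)
  ultimately show ?thesis using assms(4) by (intro linked_insert[of _ V l] perm_span.gen)
qed

lemma binomial_tree_linked_isolated:
  assumes "binomial_tree n V E u" "w \<notin> V"
  shows "linked (near_auts (insert w V) E) (insert w V)"
proof (cases "n = 0")
  case True
  then have "E = {}" using assms(1) by (simp add: binomial_tree_0)
  then have "transpose x y \<in> near_auts (insert w V) E" if "x \<in> insert w V" "y \<in> insert w V" for x y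
    using that by (simp add: near_auts_def permutes_swap_id)
  then show ?thesis unfolding linked_def by (blast intro: perm_span.gen)
next
  case False
  then obtain l where "l \<in> V" "l \<noteq> u" "{u, l} \<in> E" and El: "\<And>e. e \<in> E \<Longrightarrow> l \<in> e \<Longrightarrow> e = {u, l}"
    using binomial_tree_root_leaf[OF assms(1)] by (metis neq0_conv)
  then show ?thesis
    using binomial_tree_linked[OF assms(1)] binomial_tree_edge[OF assms(1)] binomial_tree_root[OF assms(1)] assms(2)
    by (intro linked_insert_isolated[where l = l and c = u]) (simp_all add: El)
qed

text \<open>
  Permutations of the tree fixing the root ignore the pendant edge \<open>uz\<close>; an automorphism moving the
  root replaces only that edge; and \<open>z\<close> is interchangeable with the leaf at the root.
\<close>

lemma binomial_tree_pendant_linked: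
  assumes "binomial_tree n V E u" "z \<notin> V"
  shows "linked (near_auts (insert z V) (insert {u, z} E)) (insert z V)"
proof -
  let ?S = "near_auts (insert z V) (insert {u, z} E)"
  have u: "u \<in> V" using binomial_tree_root[OF assms(1)] .
  note EV = binomial_tree_edge[OF assms(1)]
  show ?thesis
  proof (cases "n = 0")
    case True
    then have VE: "V = {u}" "E = {}" using assms(1) by (simp_all add: binomial_tree_0)
    have "transpose u z \<in> ?S"
      using VE by (intro near_autsI[where e = "{u, z}"]) (auto simp: permutes_swap_id)
    then show ?thesis
      using linked_insert[OF linked_singleton[of _ u] _ perm_span.gen] VE by simp
  next
    case False
    have "near_auts (V - {u}) E \<subseteq> near_auts (insert z V) (E \<union> {{u, z}})"
      using assms(2) by (intro near_auts_mono) auto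
    then have 1: "linked ?S (V - {u})"
      using linked_mono[OF binomial_tree_linked_off_root[OF assms(1)]] by simp
    obtain p where p: "p permutes V" "image p ` E = E" "p u \<noteq> u"
      using binomial_tree_moving_automorphism[OF assms(1)] False by blast
    have "p z = z" using permutes_not_in[OF p(1) assms(2)] .
    then have "p \<in> ?S"
      using p permutes_subset[OF p(1), of "insert z V"]
      by (intro near_autsI[where e = "{p u, z}"]) auto
    from linked_if_moves[OF 1 this p(1) u p(3)] have 2: "linked ?S V" .
    obtain l where l: "l \<in> V" "l \<noteq> u" "{u, l} \<in> E" and El: "\<And>e. e \<in> E \<Longrightarrow> l \<in> e \<Longrightarrow> e = {u, l}"
      using binomial_tree_root_leaf[OF assms(1)] False by (metis neq0_conv)
    have "transpose l z \<in> ?S"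
    proof (rule transpose_pendant_near_aut)
      show "e = {u, l} \<or> e = {u, z}" if "e \<in> insert {u, z} E" "l \<in> e \<or> z \<in> e" for e
      proof (cases "e = {u, z}")
        case False
        then have "e \<in> E" using that(1) by simp
        moreover from this have "z \<notin> e" using EV assms(2) by blast
        ultimately show ?thesis using El that(2) by simp
      qed simp
    qed (use l u assms(2) in auto)
    then show ?thesis using linked_insert[OF 2 l(1) perm_span.gen] by blast
  qed
qed

lemma binomial_tree_pendant_linked_isolated:
  assumes "binomial_tree n V E u" "z \<notin> V" "w \<notin> insert z V"
  shows "linked (near_auts (insert w (insert z V)) (insert {u, z} E)) (insert w (insert z V))"
proof (rule linked_insert_isolated[OF binomial_tree_pendant_linked[OF assms(1,2)], where l = z and c = u])
  note EV = binomial_tree_edge[OF assms(1)] and u = binomial_tree_root[OF assms(1)]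
  show "e \<subseteq> insert z V" if "e \<in> insert {u, z} E" for e
    using that EV u by blast
  show "e = {u, z}" if "e \<in> insert {u, z} E" "z \<in> e" for e
  proof (rule ccontr)
    assume "e \<noteq> {u, z}"
    then have "e \<in> E" using that(1) by simp
    then show False using EV assms(2) that(2) by blast
  qed
  show "u \<noteq> z" using u assms(2) by blast
qed (use assms(3) binomial_tree_root[OF assms(1)] in auto)

section \<open>The group of feasible edge-replacements\<close>

lemma group_sym_group_on: "group (sym_group_on X)"
proof (rule groupI)
  show "\<exists>q\<in>carrier (sym_group_on X). q \<otimes>\<^bsub>sym_group_on X\<^esub> p = \<one>\<^bsub>sym_group_on X\<^esub>"
    if "p \<in> carrier (sym_group_on X)" for p
    using that permutes_inv[of p X] permutes_inv_o(2)[of p X]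
    by (intro bexI[of _ "inv' p"]) (auto simp: sym_group_on_def)
qed (auto simp: sym_group_on_def permutes_compose permutes_id comp_assoc)

lemma inv_sym_group_on:
  assumes "p permutes X"
  shows "inv\<^bsub>sym_group_on X\<^esub> p = inv' p"
  using assms permutes_inv[OF assms] permutes_inv_o(2)[OF assms]
  by (intro group.inv_equality[OF group_sym_group_on]) (auto simp: sym_group_on_def)

lemma sym_group_on_iso_sym_group:
  assumes "finite X"
  shows "sym_group_on X \<cong> sym_group (card X)"
proof -
  obtain h where h: "bij_betw h X {1..card X}"
    using finite_same_card_bij[OF assms, of "{1..card X}"] by auto
  define \<Phi> where "\<Phi> p = (\<lambda>x. if x \<in> {1..card X} then h (p (inv_into X h x)) else x)" for p
  have "bij_betw \<Phi> {p. p permutes X} {q. q permutes {1..card X}}"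
    unfolding \<Phi>_def by (rule bij_betw_permutations[OF h])
  moreover have "\<Phi> (p \<circ> q) = \<Phi> p \<circ> \<Phi> q" if "p permutes X" "q permutes X" for p q
  proof
    fix x
    have "inv_into X h x \<in> X" if "x \<in> {1..card X}"
      using that h by (metis bij_betw_apply bij_betw_inv_into)
    then have "q (inv_into X h x) \<in> X" if "x \<in> {1..card X}"
      using that \<open>q permutes X\<close> by (simp add: permutes_in_image)
    then show "\<Phi> (p \<circ> q) x = (\<Phi> p \<circ> \<Phi> q) x"
      using bij_betw_apply[OF h] bij_betw_inv_into_left[OF h] by (auto simp: \<Phi>_def)
  qed
  moreover have "\<Phi> p permutes {1..card X}" if "p permutes X" for p
    unfolding \<Phi>_def by (rule permutes_bij_inv_into[OF that h])
  ultimately have "\<Phi> \<in> iso (sym_group_on X) (sym_group (card X))"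
    by (auto simp: iso_def hom_def sym_group_on_def sym_group_def bij_betw_apply)
  then show ?thesis by (auto simp: is_iso_def)
qed

lemma simple_graph_edgeE:
  assumes "simple_graph G" "e \<in> edges G"
  obtains a b where "e = {a, b}" "a \<noteq> b" "a \<in> verts G" "b \<in> verts G"
proof -
  have "e \<subseteq> verts G" "card e = 2" using assms by (auto simp: simple_graph_def)
  from this(2) obtain a b where "e = {a, b}" "a \<noteq> b" by (meson card_2_iff)
  with \<open>e \<subseteq> verts G\<close> show thesis using that[of a b] by simp
qed

lemma finite_edges:
  assumes "simple_graph G"
  shows "finite (edges G)"
proof (rule finite_subset)
  show "edges G \<subseteq> Pow (verts G)" using assms by (auto simp: simple_graph_def)
qed (use assms in \<open>simp add: simple_graph_def\<close>)

lemma label_edges_eq_image: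
  assumes "simple_graph G" "labeling G lab X"
  shows "label_edges G lab X = image lab ` edges G"
    and "image (vertex_of G lab) ` image lab ` edges G = edges G"
proof -
  have bij: "bij_betw lab (verts G) X" using assms(2) by (simp add: labeling_def)
  have v: "vertex_of G lab (lab a) = a" if "a \<in> verts G" for a
    using bij that by (simp add: vertex_of_def bij_betw_inv_into_left)
  have l: "lab (vertex_of G lab i) = i" if "i \<in> X" for i
    using bij that by (simp add: vertex_of_def bij_betw_inv_into_right)
  have sub: "e \<subseteq> verts G" "\<exists>a b. e = {a, b}" if "e \<in> edges G" for e
    using assms(1) that unfolding simple_graph_def card_2_iff by blast+
  show "image (vertex_of G lab) ` image lab ` edges G = edges G"
  proof -
    have "vertex_of G lab ` lab ` e = e" if "e \<in> edges G" for e
      using sub(1)[OF that] v by (force simp: image_image)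
    then show ?thesis by (simp add: image_image)
  qed
  show "label_edges G lab X = image lab ` edges G"
  proof (rule Set.set_eqI, rule iffI)
    fix e assume "e \<in> label_edges G lab X"
    then obtain i j where "e = {i, j}" "i \<in> X" "j \<in> X" "{vertex_of G lab i, vertex_of G lab j} \<in> edges G"
      by (auto simp: label_edges_def)
    then show "e \<in> image lab ` edges G"
      using l by (intro image_eqI[of _ _ "{vertex_of G lab i, vertex_of G lab j}"]) auto
  next
    fix e assume "e \<in> image lab ` edges G"
    then obtain d where d: "d \<in> edges G" "e = lab ` d" by blast
    obtain a b where ab: "d = {a, b}" using sub(2)[OF d(1)] by blast
    have "a \<in> verts G" "b \<in> verts G" using sub(1)[OF d(1)] ab by auto
    then have "lab a \<in> X" "lab b \<in> X" "{vertex_of G lab (lab a), vertex_of G lab (lab b)} \<in> edges G"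
      using bij_betw_apply[OF bij] v d(1) ab by auto
    then show "e \<in> label_edges G lab X"
      unfolding label_edges_def d(2) ab by blast
  qed
qed

text \<open>
  The permuted graph is defined by pulling label edges back along the permutation, whereas
  near-automorphisms push them forward; hence the inverse.
\<close>

lemma edges_permuted_graph:
  assumes "simple_graph G" "labeling G lab X" "p permutes X"
  shows "permuted_graph G lab X (inv' p) =
    G\<lparr>edges := image (vertex_of G lab) ` image p ` label_edges G lab X\<rparr>"
proof -
  let ?v = "vertex_of G lab" and ?L = "label_edges G lab X"
  have "{{?v i, ?v j} |i j. i \<in> X \<and> j \<in> X \<and> {inv' p i, inv' p j} \<in> ?L} = image ?v ` image p ` ?L"
  proof (rule Set.set_eqI, rule iffI)
    fix e assume "e \<in> {{?v i, ?v j} |i j. i \<in> X \<and> j \<in> X \<and> {inv' p i, inv' p j} \<in> ?L}"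
    then obtain i j where ij: "e = {?v i, ?v j}" "{inv' p i, inv' p j} \<in> ?L" by blast
    have "?v ` p ` {inv' p i, inv' p j} = e"
      using ij(1) permutes_inverses(1)[OF assms(3)] by simp
    then show "e \<in> image ?v ` image p ` ?L" using ij(2) by blast
  next
    fix e assume "e \<in> image ?v ` image p ` ?L"
    then obtain d where d: "d \<in> ?L" "e = ?v ` p ` d" by blast
    then obtain a b where ab: "d = {a, b}" "a \<in> X" "b \<in> X" by (auto simp: label_edges_def)
    have "e = {?v (p a), ?v (p b)}" "p a \<in> X" "p b \<in> X" "{inv' p (p a), inv' p (p b)} \<in> ?L"
      using ab d assms(3) by (simp_all add: permutes_in_image permutes_inverses(2))
    then show "e \<in> {{?v i, ?v j} |i j. i \<in> X \<and> j \<in> X \<and> {inv' p i, inv' p j} \<in> ?L}" by blast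
  qed
  then show ?thesis by (simp add: permuted_graph_def)
qed

lemma subset_insert_same_card:
  assumes "finite L" "card M = card L" "M \<subseteq> insert e L" "M \<noteq> L"
  obtains d where "d \<in> L" "e \<notin> L" "e \<in> M" "M = L - {d} \<union> {e}"
proof -
  have fM: "finite M" using assms(1,3) by (meson finite.insertI finite_subset)
  have nML: "\<not> M \<subseteq> L" using assms card_subset_eq by blast
  then have e: "e \<in> M" "e \<notin> L" using assms(3) by blast+
  have "card (L - M) = card (M - L)"
    using card_Diff_subset_Int[of L M] card_Diff_subset_Int[of M L] assms(1,2) fM
    by (simp add: Int_commute)
  also have "M - L = {e}" using e assms(3) by blast
  finally obtain d where "L - M = {d}" by (auto simp: card_1_singleton_iff)
  then show thesis using that[of d] e assms(3) by blast
qed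

text \<open>
  The isomorphism demanded of a feasible replacement comes for free: the permuted graph is always
  isomorphic to the original one, through the permutation itself.
\<close>

lemma near_aut_in_Fer_replacement:
  assumes G: "simple_graph G" and lab: "labeling G lab X"
    and p: "p \<in> near_auts X (image lab ` edges G)"
  shows "\<exists>\<rho>\<in>feasible_replacements G lab X. inv' p \<in> Fer_replacement G lab X \<rho>"
proof -
  let ?v = "vertex_of G lab" and ?L = "label_edges G lab X"
  have L: "?L = image lab ` edges G" and vL: "image ?v ` ?L = edges G"
    using label_edges_eq_image[OF G lab] by simp_all
  obtain e where pX: "p permutes X" and e: "image p ` ?L \<subseteq> insert e ?L"
    using p by (auto simp: near_auts_def L)
  have bij: "bij_betw lab (verts G) X" using lab by (simp add: labeling_def)
  have bijv: "bij_betw ?v X (verts G)"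
    using bij by (simp add: vertex_of_def[abs_def] bij_betw_inv_into)
  have pair: "\<exists>i\<in>X. \<exists>j\<in>X. i \<noteq> j \<and> d = {i, j}" if d: "d \<in> ?L" for d
  proof -
    obtain c where c: "c \<in> edges G" "d = lab ` c" using d unfolding L by blast
    obtain a b where ab: "c = {a, b}" "a \<noteq> b" "a \<in> verts G" "b \<in> verts G"
      using simple_graph_edgeE[OF G c(1)] .
    then have "lab a \<in> X" "lab b \<in> X" "lab a \<noteq> lab b" "d = {lab a, lab b}"
      using c(2) bij bij_betw_apply[OF bij] by (auto simp: bij_betw_def inj_on_eq_iff)
    then show ?thesis by blast
  qed
  have PL: "?L \<subseteq> Pow X" using pair by blast
  have pPL: "image p ` ?L \<subseteq> Pow X" using PL permutes_in_image[OF pX] by blast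
  have inj_v: "inj_on (image ?v) (Pow X)"
    using bijv by (intro inj_on_image_Pow) (simp add: bij_betw_def)
  have inv_p: "inv' p \<in> carrier (sym_group_on X)"
    using permutes_inv[OF pX] by (simp add: sym_group_on_def)
  note perm = edges_permuted_graph[OF G lab pX]
  show ?thesis
  proof (cases "image p ` ?L = ?L")
    case True
    then have "permuted_graph G lab X (inv' p) = G" using perm vL by simp
    then show ?thesis
      using inv_p by (intro bexI[of _ Neutral]) (auto simp: Fer_replacement_def feasible_replacements_def)
  next
    case False
    have "finite ?L" using finite_edges[OF G] by (simp add: L)
    moreover have "card (image p ` ?L) = card ?L"
      using permutes_inj[OF pX] by (intro card_image inj_on_subset[OF inj_on_image_Pow[of p UNIV]]) auto
    ultimately obtain d where d: "d \<in> ?L" "e \<notin> ?L" "e \<in> image p ` ?L" "image p ` ?L = ?L - {d} \<union> {e}"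
      using subset_insert_same_card[OF _ _ e False] by metis
    obtain r s where rs: "r \<in> X" "s \<in> X" "d = {r, s}" using pair[OF d(1)] by blast
    obtain c where c: "c \<in> ?L" "e = p ` c" using d(3) by blast
    then obtain a b where ab: "a \<in> X" "b \<in> X" "a \<noteq> b" "e = {p a, p b}"
      using pair[OF c(1)] by auto
    define k l where "k = p a" and "l = p b"
    have kl: "k \<in> X" "l \<in> X" "k \<noteq> l" "e = {k, l}"
      using ab pX permutes_inj[OF pX] by (auto simp: k_def l_def permutes_in_image inj_eq)
    have vd: "?v ` d \<in> edges G" using d(1) vL by blast
    have ve: "?v ` e \<notin> edges G"
    proof
      assume "?v ` e \<in> edges G"
      then obtain c where "c \<in> ?L" "?v ` c = ?v ` e" using vL by (metis imageE)
      then have "c = e" using inj_onD[OF inj_v] PL kl by blast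
      then show False using \<open>c \<in> ?L\<close> d(2) by simp
    qed
    have "image ?v ` (?L - {d}) = edges G - {?v ` d}"
      unfolding vL[symmetric] using inj_on_image_set_diff[OF inj_v, of ?L "{d}"] PL d(1) by auto
    then have eqE: "image ?v ` image p ` ?L = edges G - {?v ` d} \<union> {?v ` e}"
      unfolding d(4) image_Un by simp
    let ?R = "Replace {r, s} {k, l}"
    have eq: "permuted_graph G lab X (inv' p) = apply_replacement G lab ?R"
      using perm eqE rs(3) kl(4) by simp
    have "graph_iso (apply_replacement G lab ?R) G"
    proof -
      define f where "f = ?v \<circ> inv' p \<circ> lab"
      have f: "bij_betw f (verts G) (verts G)"
        unfolding f_def using bij bijv permutes_imp_bij[OF permutes_inv[OF pX]]
        by (metis bij_betw_trans)
      have "{a, b} \<in> edges (permuted_graph G lab X (inv' p)) \<longleftrightarrow> {f a, f b} \<in> edges G"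
        if "a \<in> verts G" "b \<in> verts G" for a b
      proof -
        have X: "{lab a, lab b} \<subseteq> X" "{inv' p (lab a), inv' p (lab b)} \<subseteq> X"
          using that bij_betw_apply[OF bij] permutes_in_image[OF permutes_inv[OF pX]] by auto
        have "{a, b} = ?v ` {lab a, lab b}"
          using that bij by (simp add: vertex_of_def bij_betw_inv_into_left)
        then have "{a, b} \<in> image ?v ` image p ` ?L \<longleftrightarrow> {lab a, lab b} \<in> image p ` ?L"
          using inj_on_image_mem_iff[OF inj_v, of "{lab a, lab b}" "image p ` ?L"] X(1) pPL
          by simp
        also have "{lab a, lab b} = p ` {inv' p (lab a), inv' p (lab b)}"
          using permutes_inverses(1)[OF pX] by simp
        also have "\<dots> \<in> image p ` ?L \<longleftrightarrow> {inv' p (lab a), inv' p (lab b)} \<in> ?L"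
          by (intro inj_image_mem_iff injI) (simp add: inj_image_eq_iff permutes_inj[OF pX])
        also have "\<dots> \<longleftrightarrow> ?v ` {inv' p (lab a), inv' p (lab b)} \<in> image ?v ` ?L"
          using inj_on_image_mem_iff[OF inj_v, of _ ?L] X(2) PL by blast
        also have "\<dots> \<longleftrightarrow> {f a, f b} \<in> edges G" by (simp add: vL f_def)
        finally show ?thesis by (simp add: perm)
      qed
      then show ?thesis
        unfolding eq[symmetric] graph_iso_def using f by (intro exI[of _ f]) (simp add: permuted_graph_def)
    qed
    then have "?R \<in> feasible_replacements G lab X"
      unfolding feasible_replacements_def using rs kl vd ve by auto
    then show ?thesis using inv_p eq by (intro bexI[of _ ?R]) (simp_all add: Fer_replacement_def)
  qed
qed

lemma Fer_iso_sym_group: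
  assumes G: "simple_graph G" and lab: "labeling G lab X"
    and linked: "linked (near_auts X (image lab ` edges G)) X"
  shows "Fer G lab X \<cong> sym_group (card (verts G))"
proof -
  let ?R = "\<Union>\<rho>\<in>feasible_replacements G lab X. Fer_replacement G lab X \<rho>"
  let ?\<S> = "sym_group_on X" and ?S = "near_auts X (image lab ` edges G)"
  have bij: "bij_betw lab (verts G) X" using lab by (simp add: labeling_def)
  then have fin: "finite X" using G bij_betw_finite by (auto simp: simple_graph_def)
  let ?A = "generate ?\<S> (carrier ?\<S> \<inter> ?R)"
  have R: "inv' p \<in> carrier ?\<S> \<inter> ?R" if "p \<in> ?S" for p
    using near_aut_in_Fer_replacement[OF G lab that] by (auto simp: Fer_replacement_def)
  have "p \<in> ?A" if "p \<in> perm_span ?S" for p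
    using that
  proof (induction rule: perm_span.induct)
    case (gen p)
    then have pX: "p permutes X" by (simp add: near_auts_def)
    have "inv\<^bsub>?\<S>\<^esub> (inv' p) = p"
      using inv_sym_group_on[OF permutes_inv[OF pX]] permutes_inv_inv[OF pX] by simp
    then show ?case using generate.inv[OF R[OF gen], of ?\<S>] by simp
  next
    case ident
    have "id = \<one>\<^bsub>?\<S>\<^esub>" by (simp add: sym_group_on_def)
    then show ?case by (metis generate.one)
  next
    case (comp p q)
    have "p \<circ> q = p \<otimes>\<^bsub>?\<S>\<^esub> q" by (simp add: sym_group_on_def)
    then show ?case using comp.IH by (metis generate.eng)
  next
    case (inverse p)
    then show ?case using generate.incl[OF R] by blast
  qed
  then have "carrier ?\<S> \<subseteq> ?A"
    using linked_imp_permutes_in_span[OF fin linked] by (auto simp: sym_group_on_def)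
  moreover have "?A \<subseteq> carrier ?\<S>"
    by (rule group.generate_incl[OF group_sym_group_on]) simp
  ultimately have "Fer G lab X = ?\<S>"
    by (simp add: Fer_def subgroup_generated_def sym_group_on_def)
  moreover have "card X = card (verts G)" using bij_betw_same_card[OF bij] by simp
  ultimately show ?thesis using sym_group_on_iso_sym_group[OF fin] by simp
qed

lemma simple_graph_add_K1: "simple_graph G \<Longrightarrow> simple_graph (add_K1 G)"
  by (auto simp: simple_graph_def add_K1_def card_image inj_on_def)

lemma card_verts_add_K1: "simple_graph G \<Longrightarrow> card (verts (add_K1 G)) = card (verts G) + 1"
  by (simp add: simple_graph_def add_K1_def card_image)

text \<open>
  Both notions refer to labels, and a labeling is an injection of the graph into the natural
  numbers. In the global case the label of \<open>None\<close> is the isolated vertex \<open>w\<close>.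
\<close>

lemma amoebas_if_linked:
  fixes G :: "'a sgraph"
  assumes "simple_graph G"
    and "\<And>f :: 'a \<Rightarrow> nat. inj_on f (verts G) \<Longrightarrow> linked (near_auts (f ` verts G) (image f ` edges G)) (f ` verts G)"
    and "\<And>(f :: 'a \<Rightarrow> nat) w. inj_on f (verts G) \<Longrightarrow> w \<notin> f ` verts G \<Longrightarrow>
      linked (near_auts (insert w (f ` verts G)) (image f ` edges G)) (insert w (f ` verts G))"
  shows "local_amoeba G \<and> global_amoeba G"
proof
  show "local_amoeba G"
    unfolding local_amoeba_def
  proof (intro conjI allI impI assms(1))
    fix lab :: "'a \<Rightarrow> nat" and X assume lab: "labeling G lab X"
    then have "inj_on lab (verts G)" "X = lab ` verts G" by (auto simp: labeling_def bij_betw_def)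
    then show "Fer G lab X \<cong> sym_group (card (verts G))"
      using assms(2) by (intro Fer_iso_sym_group[OF assms(1) lab]) simp
  qed
  show "global_amoeba G"
    unfolding global_amoeba_def
  proof (intro conjI allI impI assms(1))
    fix lab :: "'a option \<Rightarrow> nat" and X assume lab: "labeling (add_K1 G) lab X"
    define f where "f = lab \<circ> Some"
    have "inj_on lab (insert None (Some ` verts G))" "X = lab ` insert None (Some ` verts G)"
      using lab by (auto simp: labeling_def bij_betw_def add_K1_def)
    then have "inj_on f (verts G)" "lab None \<notin> f ` verts G" "X = insert (lab None) (f ` verts G)"
      by (auto simp: f_def inj_on_def image_image)
    then have "linked (near_auts X (image f ` edges G)) X" using assms(3) by simp
    moreover have "image f ` edges G = image lab ` edges (add_K1 G)"
      by (simp add: f_def add_K1_def image_image image_comp)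
    ultimately show "Fer (add_K1 G) lab X \<cong> sym_group (card (verts G) + 1)"
      using Fer_iso_sym_group[OF simple_graph_add_K1[OF assms(1)] lab] card_verts_add_K1[OF assms(1)]
      by simp
  qed
qed

section \<open>The trees of the definition as binomial trees\<close>

text \<open>
  The degree bounds are needed to identify the vertices of maximum degree: joining \<open>u\<close> and \<open>v\<close>
  raises exactly these two from the former maximum \<open>k - 2\<close> to \<open>k - 1\<close>, so they become the only
  vertices of maximum degree, and they are the two roots of the new binomial tree.
\<close>

lemma is_A_degrees_and_tree:
  assumes "is_A k G"
  shows "(\<exists>x\<in>verts G. vdegree G x = k - 1) \<and> (\<forall>x\<in>verts G. vdegree G x \<le> k - 1) \<and>
    (\<forall>x. max_degree_vertex G x \<longrightarrow> binomial_tree (k - 1) (verts G) (edges G) x)"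
  using assms
proof (induction rule: is_A.induct)
  case (one v)
  show ?case by (simp add: vdegree_def max_degree_vertex_def binomial_tree_0)
next
  case (step k H J u v)
  let ?G = "\<lparr>verts = verts H \<union> verts J, edges = edges H \<union> edges J \<union> {{u, v}}\<rparr>"
  have u: "u \<in> verts H" and v: "v \<in> verts J"
    using step.hyps(5,6) by (simp_all add: max_degree_vertex_def)
  have uv: "u \<notin> verts J" "v \<notin> verts H" using u v step.hyps(4) by blast+
  have sH: "e \<subseteq> verts H" if "e \<in> edges H" for e
    using is_A_simple_graph[OF step.hyps(2)] that unfolding simple_graph_def by blast
  have sJ: "e \<subseteq> verts J" if "e \<in> edges J" for e
    using is_A_simple_graph[OF step.hyps(3)] that unfolding simple_graph_def by blast
  have degH: "vdegree ?G x = vdegree H x + (if x = u then 1 else 0)" if "x \<in> verts H" for x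
  proof -
    have "{e \<in> edges ?G. x \<in> e} = {e \<in> edges H. x \<in> e} \<union> (if x = u then {{u, v}} else {})"
    proof -
      have "x \<notin> verts J" using that step.hyps(4) by blast
      then have "x \<notin> e" if "e \<in> edges J" for e using sJ[OF that] by blast
      moreover have "x \<noteq> v" using that uv by blast
      ultimately show ?thesis by auto
    qed
    moreover have "{u, v} \<notin> edges H" using sH uv by blast
    ultimately show ?thesis using finite_edges[OF is_A_simple_graph[OF step.hyps(2)]] by (simp add: vdegree_def)
  qed
  have degJ: "vdegree ?G x = vdegree J x + (if x = v then 1 else 0)" if "x \<in> verts J" for x
  proof -
    have "{e \<in> edges ?G. x \<in> e} = {e \<in> edges J. x \<in> e} \<union> (if x = v then {{u, v}} else {})"
    proof -
      have "x \<notin> verts H" using that step.hyps(4) by blast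
      then have "x \<notin> e" if "e \<in> edges H" for e using sH[OF that] by blast
      moreover have "x \<noteq> u" using that uv by blast
      ultimately show ?thesis by auto
    qed
    moreover have "{u, v} \<notin> edges J" using sJ uv by blast
    ultimately show ?thesis using finite_edges[OF is_A_simple_graph[OF step.hyps(3)]] by (simp add: vdegree_def)
  qed
  have maxdeg: "vdegree K w = k - 1 - 1"
    if "max_degree_vertex K w" "\<exists>x\<in>verts K. vdegree K x = k - 1 - 1"
      "\<forall>x\<in>verts K. vdegree K x \<le> k - 1 - 1" for K :: "'a sgraph" and w
    using that unfolding max_degree_vertex_def by (metis le_antisym)
  have "vdegree H u = k - 1 - 1" "vdegree J v = k - 1 - 1"
    using maxdeg step.hyps(5,6) step.IH by blast+
  then have du: "vdegree ?G u = k - 1" and dv: "vdegree ?G v = k - 1"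
    using degH[OF u] degJ[OF v] step.hyps(1) by simp_all
  have small: "vdegree ?G x < k - 1" if "x \<in> verts ?G" "x \<noteq> u" "x \<noteq> v" for x
  proof -
    have "x \<in> verts H \<or> x \<in> verts J" using that(1) by simp
    then have "vdegree ?G x \<le> k - 1 - 1"
    proof
      assume "x \<in> verts H"
      with step.IH(1) degH that(2) show ?thesis by simp
    next
      assume "x \<in> verts J"
      with step.IH(2) degJ that(3) show ?thesis by simp
    qed
    then show ?thesis using step.hyps(1) by simp
  qed
  have trees: "binomial_tree (k - 1 - 1) (verts H) (edges H) u" "binomial_tree (k - 1 - 1) (verts J) (edges J) v"
    using step.IH step.hyps(5,6) by blast+
  have "Suc (k - 1 - 1) = k - 1" using step.hyps(1) by simp
  then have "binomial_tree (k - 1) (verts ?G) (edges ?G) u" "binomial_tree (k - 1) (verts ?G) (edges ?G) v"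
    using binomial_tree.link[OF trees step.hyps(4)] binomial_tree.link[OF trees(2,1)] step.hyps(4)
    by (simp_all add: Un_commute Int_commute insert_commute)
  moreover have "x = u \<or> x = v" if "max_degree_vertex ?G x" for x
  proof (rule ccontr)
    assume "\<not> (x = u \<or> x = v)"
    then have "vdegree ?G x < vdegree ?G u" using that small[of x] du by (simp add: max_degree_vertex_def)
    moreover have "u \<in> verts ?G" using u by simp
    ultimately show False using that unfolding max_degree_vertex_def by (meson leD)
  qed
  moreover have "vdegree ?G x \<le> k - 1" if "x \<in> verts ?G" for x
    using small[OF that] du dv by (cases "x = u"; cases "x = v") (simp_all add: less_imp_le)
  moreover have "\<exists>x\<in>verts ?G. vdegree ?G x = k - 1" using u du by auto
  ultimately show ?case by blast
qed

lemma max_degree_vertex_binomial_root: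
  assumes "is_A k G" "max_degree_vertex G u"
  shows "binomial_tree (k - 1) (verts G) (edges G) u"
  using is_A_degrees_and_tree[OF assms(1)] assms(2) by blast

theorem theorem10:
  fixes k :: nat
  assumes "k \<ge> 1"
  shows "(\<forall>G :: 'a sgraph. is_A k G \<longrightarrow> local_amoeba G \<and> global_amoeba G) \<and>
         (\<forall>G :: 'a sgraph. is_B k G \<longrightarrow> local_amoeba G \<and> global_amoeba G)"
proof (intro conjI[of "\<forall>G. _ G"] allI impI)
  fix G :: "'a sgraph" assume G: "is_A k G"
  obtain u where "max_degree_vertex G u" using ex_max_degree_vertex[OF G] by blast
  then have "binomial_tree (k - 1) (verts G) (edges G) u"
    by (rule max_degree_vertex_binomial_root[OF G])
  then have tree: "binomial_tree (k - 1) (f ` verts G) (image f ` edges G) (f u)"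
    if "inj_on f (verts G)" for f :: "'a \<Rightarrow> nat"
    using that by (rule binomial_tree_image)
  show "local_amoeba G \<and> global_amoeba G"
    by (rule amoebas_if_linked[OF is_A_simple_graph[OF G]])
       (fact binomial_tree_linked[OF tree] binomial_tree_linked_isolated[OF tree])+
next
  fix G :: "'a sgraph" assume "is_B k G"
  then obtain H u z where H: "is_A k H" and u: "max_degree_vertex H u" and z: "z \<notin> verts H"
    and G: "G = \<lparr>verts = insert z (verts H), edges = insert {u, z} (edges H)\<rparr>"
    by (auto simp: is_B_def)
  have "u \<in> verts H" using u by (simp add: max_degree_vertex_def)
  with z have "u \<noteq> z" by blast
  then have "card {u, z} = 2" by simp
  with \<open>u \<in> verts H\<close> have simple: "simple_graph G"
    using is_A_simple_graph[OF H] by (auto simp: simple_graph_def G)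
  have tree: "binomial_tree (k - 1) (f ` verts H) (image f ` edges H) (f u)" "f z \<notin> f ` verts H"
    if "inj_on f (verts G)" for f :: "'a \<Rightarrow> nat"
    using that binomial_tree_image[OF max_degree_vertex_binomial_root[OF H u]] z
    by (auto simp: G)
  show "local_amoeba G \<and> global_amoeba G"
  proof (rule amoebas_if_linked[OF simple])
    fix f :: "'a \<Rightarrow> nat" assume f: "inj_on f (verts G)"
    have VE: "f ` verts G = insert (f z) (f ` verts H)"
      "image f ` edges G = insert {f u, f z} (image f ` edges H)"
      by (simp_all add: G)
    show "linked (near_auts (f ` verts G) (image f ` edges G)) (f ` verts G)"
      unfolding VE by (rule binomial_tree_pendant_linked[OF tree[OF f]])
    show "linked (near_auts (insert w (f ` verts G)) (image f ` edges G)) (insert w (f ` verts G))"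
      if "w \<notin> f ` verts G" for w
      using that unfolding VE by (rule binomial_tree_pendant_linked_isolated[OF tree[OF f]])
  qed
qed

end
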